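(* Consider the hybrid AC/DC network dynamics described in the context, in closed loop with the primary control scheme consisting of the droop control $$p^G = -\tilde Q\begin{bmatrix}\omega\\ mV\end{bmatrix}+p^G_{nom}$$ and, for every interlinking converter $x\in X$ with AC-side bus $i=X_x^{ac}$ and DC-side bus $j=X_x^{dc}$, the converter control $\omega_i=mV_j$, where $m>0$ is a constant. As the line resistances become arbitrarily small, the equilibrium power sharing becomes arbitrarily close to the solution of the optimal power sharing problem. That is, with all other data fixed, for every $\varepsilon>0$ there exists $\delta>0$ such that, whenever $0<R_{ij}<\delta$ for all $(i,j)\in E_{dc}$, every equilibrium of the closed-loop system, with generation vector $p^{G\ast}$ and generator-bus frequencies $\omega^{G\ast}$, satisfies $\|p^{G\ast}-p^{opt}\|<\varepsilon$, where $p^{opt}$ is the solution of $$\min_{p^G}\ \tfrac12 (p^G)^TQp^G\quad\text{subject to}\quad \mathbf 1^Tp^G=\mathbf 1^Tp^L+\sum_{j\in N_{ac}\setminus X_{ac}}D_j\omega_j^{G\ast},\qquad p^G_j=0\ \ (j\in X_{ac}).$$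
   Context: Network. $N=\{1,\dots,|N|\}$ is a finite set of buses and $E$ a finite set of transmission lines, each given an arbitrary direction. The buses are partitioned as $N=N_{ac}\cup N_{dc}$ into AC and DC buses, where $N_{ac}$ is the disjoint union of the bus sets $N_i^{ac}$ of the AC subsystems and $N_{dc}$ the disjoint union of the bus sets $N_k^{dc}$ of the DC subsystems. Each subsystem, with its lines, is a connected graph. $E=E_{ac}\cup E_{dc}$, where $E_{ac}$ (resp. $E_{dc}$) are the lines inside AC (resp. DC) subsystems; there are no lines between different subsystems. Different subsystems are connected only through interlinking converters (ILCs), forming the set $X$; ILC $x\in X$ connects an AC bus $X_x^{ac}\in N_{ac}$ to a DC bus $X_x^{dc}\in N_{dc}$. The overall network (lines together with ILCs) is connected, and each bus hosts at most one ILC. Let $X_{ac}=\{X_x^{ac}:x\in X\}$ and $X_{dc}=\{X_x^{dc}:x\in X\}$. Variables and constants. $\omega_j$ ($j\in N_{ac}$) is the AC frequency deviation from nominal, $\eta_{ij}$ ($(i,j)\in E_{ac}$) the voltage angle difference between buses $i$ and $j$, $V_j$ ($j\in N_{dc}$) the DC voltage deviation from nominal, $p^G_j$ the generated power, $p^L_j$ the (constant) load, $p_{ij}$ the power transfer on line $(i,j)$, and $p^X_j$ the power leaving bus $j$ through the ILC. One has $p^X_j=0$ for $j\notin X_{ac}\cup X_{dc}$, and $p^X_{X_x^{dc}}=-p^X_{X_x^{ac}}$ for every $x\in X$ (instantaneous lossless converters). Also $p^G_j=0$ for $j\in X_{ac}$. Inertias $M_j>0$ and damping coefficients $D_j>0$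 ($j\in N_{ac}\setminus X_{ac}$), capacitances $C_j>0$ ($j\in N_{dc}$), AC line susceptances $B_{ij}>0$ and DC line conductances $G_{ij}=1/R_{ij}>0$ (with $R_{ij}$ the line resistance; AC lines are lossless) are constants. Dynamics. $$\dot\eta_{ij}=\omega_i-\omega_j,\quad (i,j)\in E_{ac},$$ $$M_j\dot\omega_j=p^G_j-p^L_j+\sum_{i:i\to j}p_{ij}-\sum_{k:j\to k}p_{jk}-D_j\omega_j,\quad j\in N_{ac}\setminus X_{ac},$$ $$0=p^G_j-p^L_j+\sum_{i:i\to j}p_{ij}-\sum_{k:j\to k}p_{jk}-p^X_j,\quad j\in X_{ac},$$ $$C_j\dot V_j=p^G_j-p^L_j+\sum_{i:i\to j}p_{ij}-\sum_{k:j\to k}p_{jk}-p^X_j,\quad j\in N_{dc},$$ with $p_{ij}=B_{ij}\sin\eta_{ij}$ for $(i,j)\in E_{ac}$ and $p_{ij}=G_{ij}(V_i-V_j)$ for $(i,j)\in E_{dc}$. Here $i:i\to j$ and $k:j\to k$ range over predecessors and successors of $j$ in the directed graph $(N,E)$. Vectors. $\eta=[\eta_{ij}]_{(i,j)\in E_{ac}}$, $\omega=[\omega_j]_{j\in N_{ac}}$, $\omega^G=[\omega_j]_{j\in N_{ac}\setminus X_{ac}}$, $V=[V_j]_{j\in N_{dc}}$, $p^G=[p^G_j]_{j\in N}$, $p^L=[p^L_j]_{j\in N}$ (AC buses first, then DC buses). $\mathbf 1$ is the all-ones vector. Control data. $Q$ is a positive definite diagonal matrix of cost coefficients indexed by $N$;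 $\tilde Q$ is the diagonal matrix with $\tilde Q_{ii}=Q_{ii}^{-1}$ for $i\in N\setminus X_{ac}$ and $\tilde Q_{ii}=0$ for $i\in X_{ac}$. $p^G_{nom}$ is the constant nominal generation vector: the power allocation that is optimal when the frequencies are at their nominal values, i.e. the minimizer of $\frac12(p^G)^TQp^G$ subject to $p^G_j=0$ for $j\in X_{ac}$ and $\mathbf 1^Tp^G$ equal to a given nominal total load (so $p^G_{nom}=c\,\tilde Q\mathbf 1$ for some constant $c\in\mathbb R$). Equilibrium. An equilibrium is a constant state $(\eta^\ast,\omega^{G\ast},V^\ast)$ (with corresponding constant values of the remaining variables) at which $$0=\omega_i-\omega_j,\quad (i,j)\in E_{ac},$$ $$0=p^G_j-p^L_j+\sum_{i:i\to j}p_{ij}-\sum_{k:j\to k}p_{jk}-D_j\omega_j,\quad j\in N_{ac}\setminus X_{ac},$$ $$0=p^G_j-p^L_j+\sum_{i:i\to j}p_{ij}-\sum_{k:j\to k}p_{jk}-p^X_j,\quad j\in X_{ac}\cup N_{dc},$$ with $p_{ij}=B_{ij}\sin\eta_{ij}$ for $(i,j)\in E_{ac}$, $p_{ij}=G_{ij}(V_i-V_j)$ for $(i,j)\in E_{dc}$, $p^X_j=0$ for $j\notin X_{ac}\cup X_{dc}$, $p^X_{X_x^{dc}}=-p^X_{X_x^{ac}}$ for every $x\in X$, and with the control laws $p^G=-\tilde Q\begin{bmatrix}\omega\\ mV\end{bmatrix}+p^G_{nom}$ and $\omega_{X_x^{ac}}=mV_{X_x^{dc}}$ for every $x\in X$;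 in particular the frequencies of all AC buses in a common AC subsystem coincide. *)

theory Defs
  imports "HOL-Analysis.Analysis" "HOL-Library.Disjoint_Sets"
begin

text \<open>The buses are the elements of a finite type \<open>'n\<close>, so that bus-indexed vectors live in
  \<open>real ^ 'n\<close> with the Euclidean norm. A line is an ordered pair of buses, the order being its
  direction. Interlinking converters (ILCs) are labelled by a separate type \<open>'x\<close>. The line
  resistances are deliberately not part of the record: they are the quantity that tends to 0 while
  all the data below stay fixed.\<close>

record ('n, 'x) network =
  ac_subsystems :: "'n set set"
  dc_subsystems :: "'n set set"
  lines :: "('n \<times> 'n) set"
  ilcs :: "'x set"
  ac_side :: "'x \<Rightarrow> 'n"
  dc_side :: "'x \<Rightarrow> 'n"
  inertia :: "'n \<Rightarrow> real"
  damping :: "'n \<Rightarrow> real"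
  capacitance :: "'n \<Rightarrow> real"
  susceptance :: "'n \<times> 'n \<Rightarrow> real"
  load :: "'n \<Rightarrow> real"

definition ac_buses :: "('n, 'x) network \<Rightarrow> 'n set" where
  "ac_buses net = \<Union> (ac_subsystems net)"

definition dc_buses :: "('n, 'x) network \<Rightarrow> 'n set" where
  "dc_buses net = \<Union> (dc_subsystems net)"

definition ac_lines :: "('n, 'x) network \<Rightarrow> ('n \<times> 'n) set" where
  "ac_lines net = {(i, j) \<in> lines net. \<exists>S\<in>ac_subsystems net. i \<in> S \<and> j \<in> S}"

definition dc_lines :: "('n, 'x) network \<Rightarrow> ('n \<times> 'n) set" where
  "dc_lines net = {(i, j) \<in> lines net. \<exists>S\<in>dc_subsystems net. i \<in> S \<and> j \<in> S}"

definition ac_ilc_buses :: "('n, 'x) network \<Rightarrow> 'n set" where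
  "ac_ilc_buses net = ac_side net ` ilcs net"

definition dc_ilc_buses :: "('n, 'x) network \<Rightarrow> 'n set" where
  "dc_ilc_buses net = dc_side net ` ilcs net"

definition gen_ac_buses :: "('n, 'x) network \<Rightarrow> 'n set" where
  "gen_ac_buses net = ac_buses net - ac_ilc_buses net"

text \<open>Connectedness of the undirected graph with vertex set \<open>S\<close> whose edges are those pairs of
  \<open>A\<close> that have both ends in \<open>S\<close>.\<close>

definition connected_graph_on :: "'n set \<Rightarrow> ('n \<times> 'n) set \<Rightarrow> bool" where
  "connected_graph_on S A \<longleftrightarrow>
     (\<forall>u\<in>S. \<forall>v\<in>S. (u, v) \<in> ((A \<inter> S \<times> S) \<union> (A \<inter> S \<times> S)\<inverse>)\<^sup>*)"

locale hybrid_network =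
  fixes net :: "('n::finite, 'x) network"
  assumes subsystems_partition: "partition_on UNIV (ac_subsystems net \<union> dc_subsystems net)"
    and ac_dc_disjoint: "ac_subsystems net \<inter> dc_subsystems net = {}"
    and subsystem_connected:
      "\<And>S. S \<in> ac_subsystems net \<union> dc_subsystems net \<Longrightarrow> connected_graph_on S (lines net)"
    and no_lines_between: "lines net = ac_lines net \<union> dc_lines net"
    and finite_ilcs: "finite (ilcs net)"
    and ac_side_ac: "\<And>x. x \<in> ilcs net \<Longrightarrow> ac_side net x \<in> ac_buses net"
    and dc_side_dc: "\<And>x. x \<in> ilcs net \<Longrightarrow> dc_side net x \<in> dc_buses net"
    and one_ilc_per_ac_bus: "inj_on (ac_side net) (ilcs net)"
    and one_ilc_per_dc_bus: "inj_on (dc_side net) (ilcs net)"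
    and network_connected:
      "connected_graph_on UNIV (lines net \<union> (\<lambda>x. (ac_side net x, dc_side net x)) ` ilcs net)"
    and inertia_pos: "\<And>j. j \<in> gen_ac_buses net \<Longrightarrow> inertia net j > 0"
    and damping_pos: "\<And>j. j \<in> gen_ac_buses net \<Longrightarrow> damping net j > 0"
    and capacitance_pos: "\<And>j. j \<in> dc_buses net \<Longrightarrow> capacitance net j > 0"
    and susceptance_pos: "\<And>e. e \<in> ac_lines net \<Longrightarrow> susceptance net e > 0"

text \<open>Each component of a state is a total function, of which only the values on its proper index
  set are meaningful: \<open>angle\<close> on the AC lines, \<open>freq\<close> on the AC buses and \<open>volt\<close> on the DC buses.
  \<open>conv\<close> is the power leaving a bus through its ILC.\<close>

record 'n state =
  angle :: "'n \<times> 'n \<Rightarrow> real"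
  freq :: "'n \<Rightarrow> real"
  volt :: "'n \<Rightarrow> real"
  gen :: "real ^ 'n"
  conv :: "'n \<Rightarrow> real"

definition flow ::
  "('n, 'x) network \<Rightarrow> ('n \<times> 'n \<Rightarrow> real) \<Rightarrow> 'n::finite state \<Rightarrow> 'n \<times> 'n \<Rightarrow> real" where
  "flow net R s e =
     (if e \<in> ac_lines net then susceptance net e * sin (angle s e)
      else (1 / R e) * (volt s (fst e) - volt s (snd e)))"

definition power_balance ::
  "('n, 'x) network \<Rightarrow> ('n \<times> 'n \<Rightarrow> real) \<Rightarrow> 'n::finite state \<Rightarrow> 'n \<Rightarrow> real" where
  "power_balance net R s j =
     gen s $ j - load net j
     + (\<Sum>i | (i, j) \<in> lines net. flow net R s (i, j))
     - (\<Sum>k | (j, k) \<in> lines net. flow net R s (j, k))"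

definition lossless_ilcs :: "('n, 'x) network \<Rightarrow> 'n::finite state \<Rightarrow> bool" where
  "lossless_ilcs net s \<longleftrightarrow>
     (\<forall>j. j \<notin> ac_ilc_buses net \<union> dc_ilc_buses net \<longrightarrow> conv s j = 0) \<and>
     (\<forall>x\<in>ilcs net. conv s (dc_side net x) = - conv s (ac_side net x))"

definition positive_definite :: "real ^ 'n ^ 'n \<Rightarrow> bool" where
  "positive_definite A \<longleftrightarrow> transpose A = A \<and> (\<forall>x. x \<noteq> 0 \<longrightarrow> x \<bullet> (A *v x) > 0)"

definition diagonal_matrix :: "real ^ 'n ^ 'n \<Rightarrow> bool" where
  "diagonal_matrix A \<longleftrightarrow> (\<forall>i j. i \<noteq> j \<longrightarrow> A $ i $ j = 0)"

definition Q_tilde :: "('n, 'x) network \<Rightarrow> real ^ 'n ^ 'n \<Rightarrow> real ^ 'n ^ 'n::finite" where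
  "Q_tilde net Q =
     (\<chi> i j. if i = j \<and> i \<notin> ac_ilc_buses net then inverse (Q $ i $ i) else 0)"

text \<open>The stacked vector of AC frequencies and scaled DC voltages.\<close>

definition freq_volt :: "('n, 'x) network \<Rightarrow> real \<Rightarrow> 'n::finite state \<Rightarrow> real ^ 'n" where
  "freq_volt net m s = (\<chi> j. if j \<in> ac_buses net then freq s j else m * volt s j)"

definition primary_control ::
  "('n, 'x) network \<Rightarrow> real ^ 'n ^ 'n \<Rightarrow> real \<Rightarrow> real ^ 'n \<Rightarrow> 'n::finite state \<Rightarrow> bool" where
  "primary_control net Q m p_nom s \<longleftrightarrow>
     gen s = - (Q_tilde net Q *v freq_volt net m s) + p_nom \<and>
     (\<forall>x\<in>ilcs net. freq s (ac_side net x) = m * volt s (dc_side net x))"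

definition closed_loop_trajectory ::
  "('n, 'x) network \<Rightarrow> ('n \<times> 'n \<Rightarrow> real) \<Rightarrow> real ^ 'n ^ 'n \<Rightarrow> real \<Rightarrow> real ^ 'n
     \<Rightarrow> (real \<Rightarrow> 'n::finite state) \<Rightarrow> bool" where
  "closed_loop_trajectory net R Q m p_nom s \<longleftrightarrow> (\<forall>t\<ge>0.
     (\<forall>(i, j)\<in>ac_lines net.
        ((\<lambda>\<tau>. angle (s \<tau>) (i, j)) has_real_derivative freq (s t) i - freq (s t) j)
          (at t within {0..})) \<and>
     (\<forall>j\<in>gen_ac_buses net.
        ((\<lambda>\<tau>. inertia net j * freq (s \<tau>) j) has_real_derivative
            power_balance net R (s t) j - damping net j * freq (s t) j)
          (at t within {0..})) \<and>
     (\<forall>j\<in>ac_ilc_buses net. 0 = power_balance net R (s t) j - conv (s t) j) \<and>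
     (\<forall>j\<in>dc_buses net.
        ((\<lambda>\<tau>. capacitance net j * volt (s \<tau>) j) has_real_derivative
            power_balance net R (s t) j - conv (s t) j)
          (at t within {0..})) \<and>
     lossless_ilcs net (s t) \<and>
     primary_control net Q m p_nom (s t))"

definition equilibrium ::
  "('n, 'x) network \<Rightarrow> ('n \<times> 'n \<Rightarrow> real) \<Rightarrow> real ^ 'n ^ 'n \<Rightarrow> real \<Rightarrow> real ^ 'n
     \<Rightarrow> 'n::finite state \<Rightarrow> bool" where
  "equilibrium net R Q m p_nom s \<longleftrightarrow>
     (\<forall>(i, j)\<in>ac_lines net. 0 = freq s i - freq s j) \<and>
     (\<forall>j\<in>gen_ac_buses net. 0 = power_balance net R s j - damping net j * freq s j) \<and>
     (\<forall>j\<in>ac_ilc_buses net \<union> dc_buses net. 0 = power_balance net R s j - conv s j) \<and>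
     lossless_ilcs net s \<and>
     primary_control net Q m p_nom s"

lemma const_has_real_derivative_within_iff:
  fixes c d :: real
  shows "(\<forall>t\<ge>0. ((\<lambda>_. c) has_real_derivative d) (at t within {0..})) \<longleftrightarrow> d = 0"
proof
  assume "\<forall>t\<ge>0. ((\<lambda>_. c) has_real_derivative d) (at t within {0..})"
  then have "((\<lambda>_. c) has_real_derivative d) (at 1 within {0..})" by simp
  moreover have "at (1::real) within {0..} = at 1"
    by (rule at_within_interior) simp
  ultimately show "d = 0" using DERIV_unique DERIV_const by metis
qed simp

lemma equilibrium_iff_constant_trajectory:
  "equilibrium net R Q m p_nom s \<longleftrightarrow> closed_loop_trajectory net R Q m p_nom (\<lambda>_. s)"
proof -
  have "closed_loop_trajectory net R Q m p_nom (\<lambda>_. s) \<longleftrightarrow>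
     (\<forall>(i, j)\<in>ac_lines net. \<forall>t\<ge>0.
        ((\<lambda>_. angle s (i, j)) has_real_derivative freq s i - freq s j) (at t within {0..})) \<and>
     (\<forall>j\<in>gen_ac_buses net. \<forall>t\<ge>0.
        ((\<lambda>_. inertia net j * freq s j) has_real_derivative
            power_balance net R s j - damping net j * freq s j) (at t within {0..})) \<and>
     (\<forall>j\<in>ac_ilc_buses net. 0 = power_balance net R s j - conv s j) \<and>
     (\<forall>j\<in>dc_buses net. \<forall>t\<ge>0.
        ((\<lambda>_. capacitance net j * volt s j) has_real_derivative
            power_balance net R s j - conv s j) (at t within {0..})) \<and>
     lossless_ilcs net s \<and> primary_control net Q m p_nom s"
    unfolding closed_loop_trajectory_def by fastforce
  then show ?thesis
    unfolding equilibrium_def const_has_real_derivative_within_iff by auto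
qed

text \<open>Solutions of the optimal power sharing problem for a prescribed total generation.\<close>

definition optimal_sharing ::
  "('n, 'x) network \<Rightarrow> real ^ 'n ^ 'n \<Rightarrow> real \<Rightarrow> real ^ 'n::finite \<Rightarrow> bool" where
  "optimal_sharing net Q tot =
     is_arg_min (\<lambda>p. 1 / 2 * (p \<bullet> (Q *v p)))
       (\<lambda>p. (\<Sum>j\<in>UNIV. p $ j) = tot \<and> (\<forall>j\<in>ac_ilc_buses net. p $ j = 0))"

end

theory Submission imports Defs begin

text \<open>Write \<open>u\<close> for the stacked vector of frequencies and scaled voltages. Weighting the power
  balance of bus \<open>j\<close> by \<open>u j\<close> and summing, the converter terms cancel and the AC lines contribute
  nothing, so the quantities \<open>(u i - u j)\<^sup>2 / (m R)\<close> of the DC lines add up to at most a concave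
  quadratic function of \<open>u\<close>, which is bounded above independently of the equilibrium. Hence
  neighbouring values of \<open>u\<close> differ by \<open>O(sqrt R)\<close>, and so do all values, by connectedness. The
  optimal allocation is proportional to the droop gains, and its distance from the generation
  vector is the weighted deviation of \<open>u\<close> from its mean.\<close>

section \<open>Diagonal matrices, paths, weighted sums and a quadratic bound\<close>

lemma diagonal_matrix_vector_mult_nth:
  fixes A :: "real ^ 'n ^ 'n"
  assumes "diagonal_matrix A"
  shows "(A *v x) $ i = A $ i $ i * x $ i"
proof -
  have "(A *v x) $ i = (\<Sum>j\<in>UNIV. A $ i $ j * x $ j)"
    by (simp add: matrix_vector_mult_def)
  also have "\<dots> = (\<Sum>j\<in>UNIV. if j = i then A $ i $ i * x $ i else 0)"
    using assms by (intro sum.cong) (auto simp: diagonal_matrix_def)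
  finally show ?thesis by simp
qed

lemma positive_definite_diagonal_pos:
  fixes A :: "real ^ 'n ^ 'n"
  assumes "diagonal_matrix A" and "positive_definite A"
  shows "A $ i $ i > 0"
proof -
  have "0 < axis i 1 \<bullet> (A *v axis i 1)"
    using assms(2) by (auto simp: positive_definite_def axis_eq_0_iff)
  then show ?thesis
    by (simp add: inner_axis' diagonal_matrix_vector_mult_nth[OF assms(1)])
qed

text \<open>In a finite relation reachable points are joined by at most \<open>card r\<close> steps,
  and the differences telescope. Replacing \<open>card r\<close> by the number of all pairs gives a
  constant independent of \<open>r\<close>.\<close>

lemma abs_diff_le_if_rtrancl:
  fixes f :: "'a::finite \<Rightarrow> real"
  assumes step: "\<And>a b. (a, b) \<in> r \<Longrightarrow> \<bar>f a - f b\<bar> \<le> d" and "d \<ge> 0" and "(u, v) \<in> r\<^sup>*"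
  shows "\<bar>f u - f v\<bar> \<le> real CARD('a \<times> 'a) * d"
proof -
  have relpow: "\<bar>f u - f v\<bar> \<le> real n * d" if "(u, v) \<in> r ^^ n" for n v
    using that
  proof (induction n arbitrary: v)
    case (Suc n)
    then obtain w where "(u, w) \<in> r ^^ n" "(w, v) \<in> r" by auto
    then have "\<bar>f u - f w\<bar> \<le> real n * d" "\<bar>f w - f v\<bar> \<le> d"
      using Suc.IH step by auto
    then show ?case by (simp add: algebra_simps)
  qed simp
  obtain n where n: "n \<le> card r" "(u, v) \<in> r ^^ n"
    using assms(3) by (auto simp: rtrancl_finite_eq_relpow)
  have "card r \<le> CARD('a \<times> 'a)" by (intro card_mono) auto
  then have "real n * d \<le> real CARD('a \<times> 'a) * d"
    using n(1) \<open>d \<ge> 0\<close> by (intro mult_right_mono) linarith+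
  with relpow[OF n(2)] show ?thesis by linarith
qed

text \<open>Discrete summation by parts: each line occurs once as inflow, weighted at its head, and
  once as outflow, weighted at its tail.\<close>

lemma sum_inflow_minus_outflow:
  fixes p :: "'n::finite \<times> 'n \<Rightarrow> real"
  shows "(\<Sum>j\<in>UNIV. w j * ((\<Sum>i | (i, j) \<in> E. p (i, j)) - (\<Sum>k | (j, k) \<in> E. p (j, k))))
       = - (\<Sum>e\<in>E. p e * (w (fst e) - w (snd e)))"
proof -
  have split: "(\<Sum>e\<in>E. h e) = (\<Sum>i\<in>UNIV. \<Sum>j\<in>UNIV. if (i, j) \<in> E then h (i, j) else 0)"
    for h :: "'n \<times> 'n \<Rightarrow> real"
  proof -
    have "(\<Sum>i\<in>UNIV. \<Sum>j\<in>UNIV. if (i, j) \<in> E then h (i, j) else 0)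
        = (\<Sum>e\<in>UNIV. if e \<in> E then h e else 0)"
      unfolding sum.cartesian_product UNIV_Times_UNIV by (intro sum.cong) auto
    then show ?thesis by (simp add: sum.If_cases)
  qed
  have "(\<Sum>e\<in>E. p e * (w (fst e) - w (snd e)))
      = (\<Sum>e\<in>E. p e * w (fst e)) - (\<Sum>e\<in>E. p e * w (snd e))"
    by (simp add: right_diff_distrib sum_subtractf)
  moreover have "(\<Sum>e\<in>E. p e * w (fst e)) = (\<Sum>j\<in>UNIV. w j * (\<Sum>k | (j, k) \<in> E. p (j, k)))"
    unfolding split
    by (simp add: sum_distrib_left sum.If_cases mult.commute flip: sum.inter_restrict)
  moreover have "(\<Sum>e\<in>E. p e * w (snd e)) = (\<Sum>j\<in>UNIV. w j * (\<Sum>i | (i, j) \<in> E. p (i, j)))"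
    unfolding split
    by (subst sum.swap)
      (simp add: sum_distrib_left sum.If_cases mult.commute flip: sum.inter_restrict)
  ultimately show ?thesis
    by (simp add: right_diff_distrib sum_subtractf)
qed

text \<open>The deviation is a convex combination of the differences \<open>u i - u j\<close>, each
  of size at most \<open>d\<close>.\<close>

lemma weighted_mean_deviation_le:
  fixes g u :: "'n::finite \<Rightarrow> real"
  assumes "\<And>j. g j \<ge> 0" and "sum g UNIV > 0" and "\<And>i j. \<bar>u i - u j\<bar> \<le> d"
  shows "\<bar>(\<Sum>i\<in>UNIV. g i * u i) / sum g UNIV - u j\<bar> \<le> d"
proof -
  have "(\<Sum>i\<in>UNIV. g i * u i) - u j * sum g UNIV = (\<Sum>i\<in>UNIV. g i * (u i - u j))"
    by (simp add: right_diff_distrib sum_subtractf sum_distrib_left mult.commute)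
  also have "\<bar>\<dots>\<bar> \<le> (\<Sum>i\<in>UNIV. g i * d)"
    by (rule order_trans[OF sum_abs], intro sum_mono)
      (simp add: abs_mult assms(1) mult_left_mono[OF assms(3) assms(1)])
  also have "\<dots> = d * sum g UNIV"
    by (simp add: sum_distrib_left mult.commute)
  finally have "\<bar>((\<Sum>i\<in>UNIV. g i * u i) - u j * sum g UNIV) / sum g UNIV\<bar> \<le> d"
    using assms(2) by (simp add: abs_divide divide_simps)
  then show ?thesis
    using assms(2) by (simp add: diff_divide_distrib)
qed

text \<open>The quadratic term controls \<open>u\<close> only off \<open>X\<close>, which suffices since the largest \<open>\<bar>u j\<bar>\<close> is
  attained there.\<close>

lemma concave_quadratic_bounded_above:
  fixes b g :: "'n::finite \<Rightarrow> real"
  assumes nonneg: "\<And>j. g j \<ge> 0" and pos: "\<And>j. j \<notin> X \<Longrightarrow> g j > 0"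
  obtains K where "K > 0"
    and "\<And>u. (\<And>j. j \<in> X \<Longrightarrow> \<exists>k. k \<notin> X \<and> u k = u j) \<Longrightarrow>
           (\<Sum>j\<in>UNIV. u j * (b j - g j * u j)) \<le> K"
proof -
  obtain q where "q > 0" and q: "\<And>j. j \<notin> X \<Longrightarrow> g j \<ge> q"
  proof (cases "X = UNIV")
    case False
    then have "- X \<noteq> {}" by auto
    then have "Min (g ` (- X)) > 0" using pos by (subst Min_gr_iff) auto
    moreover have "\<And>j. j \<notin> X \<Longrightarrow> g j \<ge> Min (g ` (- X))" by simp
    ultimately show ?thesis using that by blast
  \<comment> \<open>If \<open>X\<close> is everything, the lower bound is vacuous and any positive
    \<open>q\<close> serves.\<close>
  qed (use that[of 1] in auto)
  define B where "B = (\<Sum>j\<in>UNIV. \<bar>b j\<bar>)"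
  show ?thesis
  proof
    \<comment> \<open>The summand 1 keeps the bound positive when \<open>b\<close> vanishes.\<close>
    show "B\<^sup>2 / (4 * q) + 1 > 0" using \<open>q > 0\<close> by (auto intro: add_nonneg_pos)
    fix u :: "'n \<Rightarrow> real"
    assume u: "\<And>j. j \<in> X \<Longrightarrow> \<exists>k. k \<notin> X \<and> u k = u j"
    have "Max (range (\<lambda>j. \<bar>u j\<bar>)) \<in> range (\<lambda>j. \<bar>u j\<bar>)" by (intro Max_in) auto
    then obtain k where "\<bar>u k\<bar> = Max (range (\<lambda>j. \<bar>u j\<bar>))" by force
    then have max: "\<bar>u j\<bar> \<le> \<bar>u k\<bar>" for j by simp
    \<comment> \<open>\<open>k\<close> maximises the modulus of \<open>u\<close> but may lie in
      \<open>X\<close>, where \<open>g\<close> can be 0; \<open>l\<close> carries the same value off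
      \<open>X\<close>.\<close>
    obtain l where "l \<notin> X" and l: "u l = u k" using u by (cases "k \<in> X") auto
    have "b j * u j \<le> \<bar>b j\<bar> * \<bar>u k\<bar>" for j
    proof -
      have "b j * u j \<le> \<bar>b j\<bar> * \<bar>u j\<bar>" by (simp flip: abs_mult)
      also have "\<dots> \<le> \<bar>b j\<bar> * \<bar>u k\<bar>" by (rule mult_left_mono[OF max]) simp
      finally show ?thesis .
    qed
    then have "(\<Sum>j\<in>UNIV. b j * u j) \<le> (\<Sum>j\<in>UNIV. \<bar>b j\<bar> * \<bar>u k\<bar>)"
      by (rule sum_mono)
    then have "(\<Sum>j\<in>UNIV. b j * u j) \<le> B * \<bar>u k\<bar>"
      by (simp add: B_def sum_distrib_right)
    moreover have "q * (u k)\<^sup>2 \<le> g l * (u l)\<^sup>2"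
      using q[OF \<open>l \<notin> X\<close>] by (simp add: l mult_right_mono)
    moreover have "g l * (u l)\<^sup>2 \<le> (\<Sum>j\<in>UNIV. g j * (u j)\<^sup>2)"
      by (rule member_le_sum) (auto simp: nonneg)
    moreover have "(\<Sum>j\<in>UNIV. u j * (b j - g j * u j))
        = (\<Sum>j\<in>UNIV. b j * u j) - (\<Sum>j\<in>UNIV. g j * (u j)\<^sup>2)"
      by (simp add: sum_subtractf[symmetric] algebra_simps power2_eq_square)
    moreover have "B * \<bar>u k\<bar> - q * (u k)\<^sup>2 \<le> B\<^sup>2 / (4 * q)"
    proof -
      \<comment> \<open>Completing the square: \<open>B\<^sup>2 / (4 * q)\<close> is the maximum of
        \<open>B * t - q * t\<^sup>2\<close> over real \<open>t\<close>.\<close>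
      have "B\<^sup>2 / (4 * q) - (B * \<bar>u k\<bar> - q * (u k)\<^sup>2) = (B - 2 * q * \<bar>u k\<bar>)\<^sup>2 / (4 * q)"
        using \<open>q > 0\<close> by (simp add: power2_diff power_mult_distrib field_simps power2_eq_square)
      also have "\<dots> \<ge> 0" using \<open>q > 0\<close> by simp
      finally show ?thesis by simp
    qed
    ultimately show "(\<Sum>j\<in>UNIV. u j * (b j - g j * u j)) \<le> B\<^sup>2 / (4 * q) + 1"
      by linarith
  qed
qed

text \<open>The diagonal of \<open>Q_tilde\<close> as a function on buses. Droop response and
  optimal allocation are both expressed through it.\<close>

definition droop_gain :: "('n, 'x) network \<Rightarrow> real ^ 'n ^ 'n \<Rightarrow> 'n::finite \<Rightarrow> real" where
  "droop_gain net Q j = (if j \<in> ac_ilc_buses net then 0 else inverse (Q $ j $ j))"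

lemma Q_tilde_mult_nth: "(Q_tilde net Q *v x) $ j = droop_gain net Q j * x $ j"
proof -
  have "diagonal_matrix (Q_tilde net Q)"
    by (simp add: diagonal_matrix_def Q_tilde_def)
  then show ?thesis
    by (simp add: diagonal_matrix_vector_mult_nth Q_tilde_def droop_gain_def)
qed

context hybrid_network
begin

section \<open>Bus classes\<close>

lemma ac_dc_buses_disjoint: "ac_buses net \<inter> dc_buses net = {}"
proof -
  have "S \<inter> T = {}" if "S \<in> ac_subsystems net" "T \<in> dc_subsystems net" for S T
  proof (rule disjointD)
    show "disjoint (ac_subsystems net \<union> dc_subsystems net)"
      using subsystems_partition by (simp add: partition_on_def)
    show "S \<noteq> T" using that ac_dc_disjoint by blast
  qed (use that in auto)
  then show ?thesis unfolding ac_buses_def dc_buses_def by blast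
qed

lemma ac_dc_buses_cover: "ac_buses net \<union> dc_buses net = UNIV"
  using subsystems_partition by (auto simp: partition_on_def ac_buses_def dc_buses_def)

lemma ac_ilc_buses_subset: "ac_ilc_buses net \<subseteq> ac_buses net"
  by (auto simp: ac_ilc_buses_def intro: ac_side_ac)

lemma dc_ilc_buses_subset: "dc_ilc_buses net \<subseteq> dc_buses net"
  by (auto simp: dc_ilc_buses_def intro: dc_side_dc)

lemma dc_side_not_ac_ilc:
  assumes "x \<in> ilcs net"
  shows "dc_side net x \<notin> ac_ilc_buses net"
  using dc_side_dc[OF assms] ac_dc_buses_disjoint ac_ilc_buses_subset by blast

text \<open>This makes the total droop gain positive, so that one may divide by it. With converters
  present, the DC side of any of them is a witness.\<close>

lemma exists_non_ac_ilc_bus: "\<exists>j. j \<notin> ac_ilc_buses net"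
proof (cases "ilcs net = {}")
  case True
  then show ?thesis by (simp add: ac_ilc_buses_def)
next
  case False
  then obtain x where "x \<in> ilcs net" by blast
  from dc_side_not_ac_ilc[OF this] show ?thesis by blast
qed

section \<open>Power balance summed over the network\<close>

lemma sum_conv_eq_0:
  assumes "lossless_ilcs net s"
    and w: "\<And>x. x \<in> ilcs net \<Longrightarrow> w (ac_side net x) = w (dc_side net x)"
  shows "(\<Sum>j\<in>UNIV. w j * conv s j) = (0::real)"
proof -
  have "(\<Sum>j\<in>UNIV. w j * conv s j) = (\<Sum>j\<in>ac_ilc_buses net \<union> dc_ilc_buses net. w j * conv s j)"
    using assms(1) by (intro sum.mono_neutral_right) (auto simp: lossless_ilcs_def)
  also have "\<dots> = (\<Sum>j\<in>ac_ilc_buses net. w j * conv s j) + (\<Sum>j\<in>dc_ilc_buses net. w j * conv s j)"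
    using ac_ilc_buses_subset dc_ilc_buses_subset ac_dc_buses_disjoint
    by (intro sum.union_disjoint) auto
  \<comment> \<open>As each bus hosts at most one converter, both bus sums can be indexed by
    converters; there opposite powers meet equal weights.\<close>
  also have "\<dots> = (\<Sum>x\<in>ilcs net. w (ac_side net x) * conv s (ac_side net x)
      + w (dc_side net x) * conv s (dc_side net x))"
    by (simp add: ac_ilc_buses_def dc_ilc_buses_def sum.reindex one_ilc_per_ac_bus
        one_ilc_per_dc_bus sum.distrib)
  also have "\<dots> = 0"
    using assms(1) by (intro sum.neutral) (simp add: lossless_ilcs_def w)
  finally show ?thesis .
qed

text \<open>Equal weights on both sides of each converter remove the converter powers, leaving only
  line terms. Constant weights give the total generation, the weights \<open>freq_volt\<close> the
  energy estimate.\<close>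

lemma weighted_power_balance:
  assumes eq: "equilibrium net R Q m p_nom s"
    and w: "\<And>x. x \<in> ilcs net \<Longrightarrow> w (ac_side net x) = w (dc_side net x)"
  shows "(\<Sum>j\<in>UNIV. w j * (gen s $ j - load net j))
           - (\<Sum>j\<in>gen_ac_buses net. w j * (damping net j * freq s j))
         = (\<Sum>e\<in>lines net. flow net R s e * (w (fst e) - w (snd e)))"
proof -
  \<comment> \<open>Extending the damping power by 0 gives one equation for all buses: generator AC
    buses have no converter power, the others no damping.\<close>
  define D where "D j = (if j \<in> gen_ac_buses net then damping net j * freq s j else 0)" for j
  define T where "T j = (\<Sum>i | (i, j) \<in> lines net. flow net R s (i, j))
      - (\<Sum>k | (j, k) \<in> lines net. flow net R s (j, k))" for j
  have "w j * (gen s $ j - load net j) - w j * D j - w j * conv s j + w j * T j = 0" for j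
  proof -
    have "power_balance net R s j - D j - conv s j = 0"
    proof (cases "j \<in> gen_ac_buses net")
      case True
      then have "j \<notin> ac_ilc_buses net \<union> dc_ilc_buses net"
        using ac_dc_buses_disjoint dc_ilc_buses_subset unfolding gen_ac_buses_def by blast
      with True eq show ?thesis
        by (auto simp: equilibrium_def lossless_ilcs_def D_def)
    next
      case False
      then have "j \<in> ac_ilc_buses net \<union> dc_buses net"
        using ac_dc_buses_cover unfolding gen_ac_buses_def by blast
      with False eq show ?thesis
        by (auto simp: equilibrium_def D_def)
    qed
    then have "w j * (gen s $ j - load net j + T j - D j - conv s j) = 0"
      by (simp add: power_balance_def T_def)
    then show ?thesis by (simp add: algebra_simps)
  qed
  then have "(\<Sum>j\<in>UNIV. w j * (gen s $ j - load net j) - w j * D j - w j * conv s j + w j * T j) = 0"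
    by simp
  moreover have "(\<Sum>j\<in>UNIV. w j * T j) = - (\<Sum>e\<in>lines net. flow net R s e * (w (fst e) - w (snd e)))"
    unfolding T_def by (rule sum_inflow_minus_outflow)
  moreover have "(\<Sum>j\<in>UNIV. w j * conv s j) = 0"
    using eq by (intro sum_conv_eq_0 w) (simp_all add: equilibrium_def)
  moreover have "(\<Sum>j\<in>UNIV. w j * D j) = (\<Sum>j\<in>gen_ac_buses net. w j * (damping net j * freq s j))"
    by (rule sum.mono_neutral_cong_right) (auto simp: D_def)
  ultimately show ?thesis
    by (simp add: sum.distrib sum_subtractf)
qed

text \<open>Hence the total prescribed in the optimal sharing problem is the total actually
  generated at equilibrium.\<close>

lemma total_generation:
  assumes "equilibrium net R Q m p_nom s"
  shows "(\<Sum>j\<in>UNIV. gen s $ j)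
    = (\<Sum>j\<in>UNIV. load net j) + (\<Sum>j\<in>gen_ac_buses net. damping net j * freq s j)"
  using weighted_power_balance[OF assms, of "\<lambda>_. 1"] by (simp add: sum_subtractf)

section \<open>Variation of \<open>freq_volt\<close> across converters and lines\<close>

lemma ilc_freq_volt_eq:
  assumes "primary_control net Q m p_nom s" and "x \<in> ilcs net"
  shows "freq_volt net m s $ ac_side net x = freq_volt net m s $ dc_side net x"
proof -
  have "ac_side net x \<in> ac_buses net" "dc_side net x \<notin> ac_buses net"
    using ac_side_ac[OF assms(2)] dc_side_dc[OF assms(2)] ac_dc_buses_disjoint by blast+
  moreover have "freq s (ac_side net x) = m * volt s (dc_side net x)"
    using assms by (simp add: primary_control_def)
  ultimately show ?thesis by (simp add: freq_volt_def)
qed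

lemma ac_line_freq_volt_eq:
  assumes "equilibrium net R Q m p_nom s" and "e \<in> ac_lines net"
  shows "freq_volt net m s $ fst e = freq_volt net m s $ snd e"
proof -
  have "fst e \<in> ac_buses net" "snd e \<in> ac_buses net"
    using assms(2) by (auto simp: ac_lines_def ac_buses_def)
  moreover have "freq s (fst e) = freq s (snd e)"
    using assms by (auto simp: equilibrium_def)
  ultimately show ?thesis by (simp add: freq_volt_def)
qed

lemma dc_line_freq_volt:
  assumes "e \<in> dc_lines net"
  shows "freq_volt net m s $ fst e = m * volt s (fst e)"
    and "freq_volt net m s $ snd e = m * volt s (snd e)"
proof -
  have "fst e \<in> dc_buses net" "snd e \<in> dc_buses net"
    using assms by (auto simp: dc_lines_def dc_buses_def)
  then have "fst e \<notin> ac_buses net" "snd e \<notin> ac_buses net"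
    using ac_dc_buses_disjoint by auto
  then show "freq_volt net m s $ fst e = m * volt s (fst e)"
    "freq_volt net m s $ snd e = m * volt s (snd e)"
    by (simp_all add: freq_volt_def)
qed

text \<open>On an AC line the end frequencies agree, whatever the angle. On a DC line
  \<open>u\<close> is \<open>m\<close> times the voltage, so Ohm's law gives a square, with
  \<open>m\<close> left in the denominator.\<close>

lemma flow_times_drop:
  assumes "equilibrium net R Q m p_nom s" and "m > 0" and "e \<in> lines net"
  defines "u \<equiv> \<lambda>j. freq_volt net m s $ j"
  shows "flow net R s e * (u (fst e) - u (snd e))
    = (if e \<in> ac_lines net then 0 else (u (fst e) - u (snd e))\<^sup>2 / (m * R e))"
proof (cases "e \<in> ac_lines net")
  case True
  then show ?thesis using ac_line_freq_volt_eq[OF assms(1)] by (simp add: u_def)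
next
  case False
  then have "e \<in> dc_lines net" using assms(3) no_lines_between by auto
  then have "volt s (fst e) = u (fst e) / m" "volt s (snd e) = u (snd e) / m"
    using \<open>m > 0\<close> by (simp_all add: u_def dc_line_freq_volt)
  with False show ?thesis
    by (simp add: flow_def power2_eq_square diff_divide_distrib[symmetric])
qed

text \<open>All products of flow and drop are nonnegative, so each is at most their sum. The balance
  weighted by \<open>u\<close> bounds this sum by \<open>K\<close>, as damping only subtracts; a
  small resistance then forces a small drop.\<close>

lemma line_drop_bounded:
  assumes eq: "equilibrium net R Q m p_nom s" and "m > 0"
    and R: "\<And>e. e \<in> dc_lines net \<Longrightarrow> 0 < R e \<and> R e < \<delta>" and "\<delta> > 0" and "K > 0"
  defines "u \<equiv> \<lambda>j. freq_volt net m s $ j"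
  assumes K: "(\<Sum>j\<in>UNIV. u j * (gen s $ j - load net j)) \<le> K"
    and "e \<in> lines net"
  shows "\<bar>u (fst e) - u (snd e)\<bar> \<le> sqrt (m * \<delta> * K)"
proof (cases "e \<in> ac_lines net")
  case True
  then show ?thesis
    using ac_line_freq_volt_eq[OF eq] \<open>m > 0\<close> \<open>\<delta> > 0\<close> \<open>K > 0\<close> by (simp add: u_def)
next
  case False
  let ?h = "\<lambda>e. flow net R s e * (u (fst e) - u (snd e))"
  have h: "?h e = (if e \<in> ac_lines net then 0 else (u (fst e) - u (snd e))\<^sup>2 / (m * R e))"
    if "e \<in> lines net" for e
    using flow_times_drop[OF eq \<open>m > 0\<close> that] by (simp add: u_def)
  have dc: "0 < R e \<and> R e < \<delta>" if "e \<in> lines net" "e \<notin> ac_lines net" for e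
    using that R no_lines_between by auto
  have nonneg: "0 \<le> ?h e" if "e \<in> lines net" for e
    using h[OF that] dc[OF that] \<open>m > 0\<close> by (auto intro!: divide_nonneg_nonneg)
  have "?h e \<le> (\<Sum>e\<in>lines net. ?h e)"
    using \<open>e \<in> lines net\<close> by (intro member_le_sum nonneg) auto
  also have "\<dots> = (\<Sum>j\<in>UNIV. u j * (gen s $ j - load net j))
      - (\<Sum>j\<in>gen_ac_buses net. u j * (damping net j * freq s j))"
    using eq by (intro weighted_power_balance[symmetric, OF eq])
      (auto simp: u_def equilibrium_def intro: ilc_freq_volt_eq)
  also have "\<dots> \<le> K"
  proof -
    have "0 \<le> u j * (damping net j * freq s j)" if "j \<in> gen_ac_buses net" for j
    proof -
      \<comment> \<open>The term becomes the damping coefficient times the squared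
        frequency.\<close>
      have "u j = freq s j" using that by (simp add: u_def freq_volt_def gen_ac_buses_def)
      then show ?thesis using damping_pos[OF that] by (simp add: mult.left_commute)
    qed
    then have "0 \<le> (\<Sum>j\<in>gen_ac_buses net. u j * (damping net j * freq s j))"
      by (rule sum_nonneg)
    with K show ?thesis by linarith
  qed
  finally have "(u (fst e) - u (snd e))\<^sup>2 / (m * R e) \<le> K"
    using h[OF \<open>e \<in> lines net\<close>] False by simp
  moreover have Re: "0 < R e" "R e < \<delta>" using dc[OF \<open>e \<in> lines net\<close> False] by auto
  ultimately have "(u (fst e) - u (snd e))\<^sup>2 \<le> m * R e * K"
    using \<open>m > 0\<close> by (simp add: field_simps)
  also have "\<dots> \<le> m * \<delta> * K"
    using Re \<open>m > 0\<close> \<open>K > 0\<close> by simp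
  finally show ?thesis by (metis real_sqrt_abs real_sqrt_le_iff)
qed

text \<open>Converters connect buses of equal value, so along a path in the connected network only
  lines change \<open>u\<close>, each by at most \<open>d\<close>.\<close>

lemma freq_volt_oscillation_le:
  assumes "primary_control net Q m p_nom s"
  defines "u \<equiv> \<lambda>j. freq_volt net m s $ j"
  assumes line: "\<And>e. e \<in> lines net \<Longrightarrow> \<bar>u (fst e) - u (snd e)\<bar> \<le> d" and "d \<ge> 0"
  shows "\<bar>u i - u j\<bar> \<le> real CARD('n \<times> 'n) * d"
proof -
  define A where "A = lines net \<union> (\<lambda>x. (ac_side net x, dc_side net x)) ` ilcs net"
  have A: "\<bar>u a - u b\<bar> \<le> d" if "(a, b) \<in> A" for a b
    using that unfolding A_def
  proof
    assume "(a, b) \<in> lines net"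
    from line[OF this] show ?thesis by simp
  next
    assume "(a, b) \<in> (\<lambda>x. (ac_side net x, dc_side net x)) ` ilcs net"
    then show ?thesis using ilc_freq_volt_eq[OF assms(1)] \<open>d \<ge> 0\<close> by (auto simp: u_def)
  qed
  have step: "\<bar>u a - u b\<bar> \<le> d" if "(a, b) \<in> A \<union> A\<inverse>" for a b
    using that
  proof
    assume "(a, b) \<in> A\<inverse>"
    then have "(b, a) \<in> A" by simp
    from A[OF this] show ?thesis by (simp add: abs_minus_commute)
  qed (rule A)
  have "(i, j) \<in> (A \<union> A\<inverse>)\<^sup>*"
    using network_connected by (simp add: connected_graph_on_def A_def)
  with step \<open>d \<ge> 0\<close> show ?thesis by (rule abs_diff_le_if_rtrancl)
qed

section \<open>Optimal sharing and droop control\<close>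

context
  fixes Q :: "real ^ 'n ^ 'n"
  assumes diagonal: "diagonal_matrix Q" and posdef: "positive_definite Q"
begin

lemma droop_gain_pos: "j \<notin> ac_ilc_buses net \<Longrightarrow> droop_gain net Q j > 0"
  using positive_definite_diagonal_pos[OF diagonal posdef] by (simp add: droop_gain_def)

lemma droop_gain_nonneg: "droop_gain net Q j \<ge> 0"
  using droop_gain_pos[of j] by (cases "j \<in> ac_ilc_buses net") (auto simp: droop_gain_def)

lemma sum_droop_gain_pos: "sum (droop_gain net Q) UNIV > 0"
proof -
  obtain j where "j \<notin> ac_ilc_buses net" using exists_non_ac_ilc_bus by blast
  from droop_gain_pos[OF this] show ?thesis
    by (intro sum_pos2[of UNIV j]) (simp_all add: droop_gain_nonneg)
qed

text \<open>Lagrange condition with multiplier \<open>c\<close>: for feasible \<open>p\<close> the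
  cross term between \<open>p0\<close> and \<open>p - p0\<close> vanishes, so the cost exceeds that
  of \<open>p0\<close> by the cost of \<open>p - p0\<close>.\<close>

lemma optimal_sharing_iff:
  "optimal_sharing net Q tot p
    \<longleftrightarrow> p = (\<chi> j. tot / sum (droop_gain net Q) UNIV * droop_gain net Q j)"
proof -
  define c where "c = tot / sum (droop_gain net Q) UNIV"
  define p0 :: "real ^ 'n" where "p0 = (\<chi> j. c * droop_gain net Q j)"
  define F where "F p \<longleftrightarrow> (\<Sum>j\<in>UNIV. p $ j) = tot \<and> (\<forall>j\<in>ac_ilc_buses net. p $ j = 0)"
    for p :: "real ^ 'n"
  define f where "f p = 1 / 2 * (p \<bullet> (Q *v p))" for p :: "real ^ 'n"
  have "(\<Sum>j\<in>UNIV. p0 $ j) = c * sum (droop_gain net Q) UNIV"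
    by (simp add: p0_def sum_distrib_left)
  then have "(\<Sum>j\<in>UNIV. p0 $ j) = tot"
    using sum_droop_gain_pos by (simp add: c_def)
  then have F0: "F p0"
    by (simp add: F_def p0_def droop_gain_def)
  have f_less: "f p0 < f p" if "F p" "p \<noteq> p0" for p
  proof -
    \<comment> \<open>Off the AC converter buses, the marginal cost \<open>Q p0\<close> has the constant value \<open>c\<close>.\<close>
    have summand: "p $ j * (Q $ j $ j * p $ j) = p0 $ j * (Q $ j $ j * p0 $ j)
        + (p - p0) $ j * (Q $ j $ j * (p - p0) $ j) + 2 * c * (p $ j - p0 $ j)" for j
    proof (cases "j \<in> ac_ilc_buses net")
      case True
      then show ?thesis using that(1) F0 by (simp add: F_def)
    next
      case False
      then have "Q $ j $ j * p0 $ j = c"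
        using positive_definite_diagonal_pos[OF diagonal posdef, of j]
        by (simp add: p0_def droop_gain_def)
      then show ?thesis by (simp add: algebra_simps)
    qed
    have inner: "x \<bullet> (Q *v x) = (\<Sum>j\<in>UNIV. x $ j * (Q $ j $ j * x $ j))" for x
      by (simp add: inner_vec_def diagonal_matrix_vector_mult_nth[OF diagonal])
    \<comment> \<open>The cross terms sum to 0 because \<open>p\<close> and \<open>p0\<close> have
      the same total.\<close>
    have "(\<Sum>j\<in>UNIV. 2 * c * (p $ j - p0 $ j)) = 0"
      using that(1) F0 by (simp add: F_def sum_subtractf flip: sum_distrib_left)
    then have "p \<bullet> (Q *v p) = p0 \<bullet> (Q *v p0) + (p - p0) \<bullet> (Q *v (p - p0))"
      unfolding inner by (subst summand) (simp add: sum.distrib)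
    moreover have "(p - p0) \<bullet> (Q *v (p - p0)) > 0"
      using posdef that(2) by (simp add: positive_definite_def)
    ultimately show ?thesis by (simp add: f_def)
  qed
  have "optimal_sharing net Q tot p \<longleftrightarrow> F p \<and> \<not> (\<exists>y. F y \<and> f y < f p)"
    by (simp add: optimal_sharing_def is_arg_min_def F_def f_def)
  also have "\<dots> \<longleftrightarrow> p = p0"
    using F0 f_less by (metis order_less_imp_not_less order_less_irrefl)
  finally show ?thesis by (simp add: p0_def c_def)
qed

text \<open>As an optimum, \<open>p_nom\<close> is proportional to the droop gains, so the gain
  factors out of the control law.\<close>

lemma gen_eq:
  assumes "primary_control net Q m p_nom s"
    and "optimal_sharing net Q nominal_load p_nom"
  shows "gen s $ j = droop_gain net Q j *
    (nominal_load / sum (droop_gain net Q) UNIV - freq_volt net m s $ j)"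
proof -
  have "gen s = - (Q_tilde net Q *v freq_volt net m s) + p_nom"
    using assms(1) by (simp add: primary_control_def)
  moreover have "p_nom $ j = nominal_load / sum (droop_gain net Q) UNIV * droop_gain net Q j"
    using assms(2) by (simp add: optimal_sharing_iff)
  ultimately show ?thesis
    by (simp add: Q_tilde_mult_nth right_diff_distrib mult.commute)
qed

text \<open>The optimum with the same total arises from \<open>gen s\<close> by replacing each entry
  of \<open>freq_volt\<close> by their gain-weighted mean, so the error at a bus is its gain times a
  deviation from that mean.\<close>

lemma norm_gen_minus_optimal_le:
  assumes "equilibrium net R Q m p_nom s"
    and "optimal_sharing net Q nominal_load p_nom"
    and "optimal_sharing net Q (\<Sum>j\<in>UNIV. gen s $ j) p"
    and "\<And>i j. \<bar>freq_volt net m s $ i - freq_volt net m s $ j\<bar> \<le> d"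
  shows "norm (gen s - p) \<le> sum (droop_gain net Q) UNIV * d"
proof -
  let ?g = "droop_gain net Q" and ?u = "\<lambda>j. freq_volt net m s $ j"
  let ?S = "sum ?g UNIV"
  let ?c = "nominal_load / ?S"
  have gen: "gen s $ j = ?g j * (?c - ?u j)" for j
    using assms(1,2) by (intro gen_eq) (auto simp: equilibrium_def)
  have "(\<Sum>j\<in>UNIV. gen s $ j) = (\<Sum>j\<in>UNIV. ?c * ?g j - ?g j * ?u j)"
    by (simp only: gen right_diff_distrib mult.commute)
  also have "\<dots> = ?c * ?S - (\<Sum>j\<in>UNIV. ?g j * ?u j)"
    by (simp only: sum_subtractf sum_distrib_left)
  finally have mean: "(\<Sum>j\<in>UNIV. gen s $ j) / ?S = ?c - (\<Sum>j\<in>UNIV. ?g j * ?u j) / ?S"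
    using sum_droop_gain_pos by (simp add: diff_divide_distrib)
  have p: "p $ j = (?c - (\<Sum>j\<in>UNIV. ?g j * ?u j) / ?S) * ?g j" for j
    using assms(3) unfolding optimal_sharing_iff mean by simp
  have diff: "(gen s - p) $ j = ?g j * ((\<Sum>j\<in>UNIV. ?g j * ?u j) / ?S - ?u j)" for j
    by (simp add: gen p algebra_simps)
  have "norm (gen s - p) \<le> (\<Sum>j\<in>UNIV. \<bar>(gen s - p) $ j\<bar>)"
    by (rule norm_le_l1_cart)
  also have "\<dots> \<le> (\<Sum>j\<in>UNIV. ?g j * d)"
    unfolding diff abs_mult
    by (intro sum_mono mult_mono weighted_mean_deviation_le)
      (auto simp: droop_gain_nonneg sum_droop_gain_pos assms(4))
  finally show ?thesis by (simp add: sum_distrib_right)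
qed

text \<open>Under droop control the sum is a concave quadratic in \<open>freq_volt\<close> whose
  coefficients involve neither \<open>R\<close> nor \<open>s\<close>; hence one \<open>K\<close>
  serves all resistances and equilibria.\<close>

lemma equilibrium_power_bounded:
  assumes "optimal_sharing net Q nominal_load p_nom"
  obtains K where "K > 0" and "\<And>R s. equilibrium net R Q m p_nom s \<Longrightarrow>
    (\<Sum>j\<in>UNIV. freq_volt net m s $ j * (gen s $ j - load net j)) \<le> K"
proof -
  let ?g = "droop_gain net Q"
  let ?c = "nominal_load / sum ?g UNIV"
  show ?thesis
  proof (rule concave_quadratic_bounded_above
      [of ?g "ac_ilc_buses net" "\<lambda>j. ?g j * ?c - load net j"])
    show "?g j \<ge> 0" for j by (rule droop_gain_nonneg)
    show "?g j > 0" if "j \<notin> ac_ilc_buses net" for j using that by (rule droop_gain_pos)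
    fix K :: real
    assume "K > 0" and K: "\<And>u. (\<And>j. j \<in> ac_ilc_buses net \<Longrightarrow>
        \<exists>k. k \<notin> ac_ilc_buses net \<and> u k = u j) \<Longrightarrow>
        (\<Sum>j\<in>UNIV. u j * ((?g j * ?c - load net j) - ?g j * u j)) \<le> K"
    show thesis
    proof (rule that[OF \<open>K > 0\<close>])
      fix R s
      assume "equilibrium net R Q m p_nom s"
      then have pc: "primary_control net Q m p_nom s" by (simp add: equilibrium_def)
      let ?u = "\<lambda>j. freq_volt net m s $ j"
      have "(\<Sum>j\<in>UNIV. ?u j * ((?g j * ?c - load net j) - ?g j * ?u j)) \<le> K"
      proof (rule K)
        fix j
        assume "j \<in> ac_ilc_buses net"
        then obtain x where x: "x \<in> ilcs net" and j: "j = ac_side net x"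
          by (auto simp: ac_ilc_buses_def)
        \<comment> \<open>Converter control repeats the value of an AC converter bus at the DC side,
          where the gain is positive.\<close>
        show "\<exists>k. k \<notin> ac_ilc_buses net \<and> ?u k = ?u j"
          using ilc_freq_volt_eq[OF pc x] dc_side_not_ac_ilc[OF x]
          by (intro exI[of _ "dc_side net x"]) (simp add: j)
      qed
      also have "(\<Sum>j\<in>UNIV. ?u j * ((?g j * ?c - load net j) - ?g j * ?u j))
          = (\<Sum>j\<in>UNIV. ?u j * (gen s $ j - load net j))"
        by (simp add: gen_eq[OF pc assms] right_diff_distrib algebra_simps)
      finally show "(\<Sum>j\<in>UNIV. ?u j * (gen s $ j - load net j)) \<le> K" .
    qed
  qed
qed

end

end

section \<open>Choice of the resistance threshold\<close>

theorem theorem2: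
  fixes net :: "('n::finite, 'x) network"
    and Q :: "real ^ 'n ^ 'n"
    and m nominal_load :: real
    and p_nom :: "real ^ 'n"
  assumes "hybrid_network net"
    and "diagonal_matrix Q"
    and "positive_definite Q"
    and "m > 0"
    and "optimal_sharing net Q nominal_load p_nom"
  shows "\<forall>\<epsilon>>0. \<exists>\<delta>>0. \<forall>R :: 'n \<times> 'n \<Rightarrow> real.
           (\<forall>e\<in>dc_lines net. 0 < R e \<and> R e < \<delta>) \<longrightarrow>
           (\<forall>s. equilibrium net R Q m p_nom s \<longrightarrow>
              (let tot = (\<Sum>j\<in>UNIV. load net j)
                           + (\<Sum>j\<in>gen_ac_buses net. damping net j * freq s j)
               in (\<exists>!p_opt. optimal_sharing net Q tot p_opt) \<and>
                  (\<forall>p_opt. optimal_sharing net Q tot p_opt \<longrightarrow> norm (gen s - p_opt) < \<epsilon>)))"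
proof (intro allI impI)
  interpret hybrid_network net by (rule assms(1))
  note Q = assms(2,3)
  fix \<epsilon> :: real
  assume "\<epsilon> > 0"
  obtain K where "K > 0" and K: "\<And>R s. equilibrium net R Q m p_nom s \<Longrightarrow>
      (\<Sum>j\<in>UNIV. freq_volt net m s $ j * (gen s $ j - load net j)) \<le> K"
    using equilibrium_power_bounded[OF Q assms(5)] by blast
  let ?L = "real CARD('n \<times> 'n)" and ?S = "sum (droop_gain net Q) UNIV"
  have "?S > 0" by (rule sum_droop_gain_pos[OF Q])
  have "?L > 0" by (simp only: of_nat_0_less_iff zero_less_card_finite)
  \<comment> \<open>The admissible drop per line: accumulated along paths and weighted by the gains
    it costs half of \<open>\<epsilon>\<close>, which makes the final inequality strict.\<close>
  define d where "d = \<epsilon> / (2 * (?S * ?L))"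
  have "d > 0" unfolding d_def using \<open>\<epsilon> > 0\<close> \<open>?S > 0\<close> \<open>?L > 0\<close> by (intro divide_pos_pos mult_pos_pos) auto
  have d: "?S * (?L * d) < \<epsilon>"
  proof -
    have "?S * (?L * d) = \<epsilon> / 2"
      unfolding d_def using \<open>?S > 0\<close> \<open>?L > 0\<close> by (simp del: card_prod)
    then show ?thesis using \<open>\<epsilon> > 0\<close> by linarith
  qed
  \<comment> \<open>Solves \<open>sqrt (m * \<delta> * K) = d\<close>; \<open>K\<close> was fixed
    before any resistance was chosen.\<close>
  define \<delta> where "\<delta> = d\<^sup>2 / (m * K)"
  have "\<delta> > 0" using \<open>d > 0\<close> \<open>m > 0\<close> \<open>K > 0\<close> by (simp add: \<delta>_def)
  have sqrt: "sqrt (m * \<delta> * K) = d"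
    using \<open>d > 0\<close> \<open>m > 0\<close> \<open>K > 0\<close> by (simp add: \<delta>_def)
  show "\<exists>\<delta>>0. \<forall>R :: 'n \<times> 'n \<Rightarrow> real.
           (\<forall>e\<in>dc_lines net. 0 < R e \<and> R e < \<delta>) \<longrightarrow>
           (\<forall>s. equilibrium net R Q m p_nom s \<longrightarrow>
              (let tot = (\<Sum>j\<in>UNIV. load net j)
                           + (\<Sum>j\<in>gen_ac_buses net. damping net j * freq s j)
               in (\<exists>!p_opt. optimal_sharing net Q tot p_opt) \<and>
                  (\<forall>p_opt. optimal_sharing net Q tot p_opt \<longrightarrow> norm (gen s - p_opt) < \<epsilon>)))"
    unfolding Let_def
  proof (intro exI[of _ \<delta>] conjI allI impI \<open>\<delta> > 0\<close>)
    fix R :: "'n \<times> 'n \<Rightarrow> real" and s :: "'n state"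
    assume R: "\<forall>e\<in>dc_lines net. 0 < R e \<and> R e < \<delta>" and eq: "equilibrium net R Q m p_nom s"
    let ?tot = "(\<Sum>j\<in>UNIV. load net j) + (\<Sum>j\<in>gen_ac_buses net. damping net j * freq s j)"
    show "\<exists>!p_opt. optimal_sharing net Q ?tot p_opt"
      by (simp add: optimal_sharing_iff[OF Q])
    fix p_opt
    assume opt: "optimal_sharing net Q ?tot p_opt"
    have "\<bar>freq_volt net m s $ fst e - freq_volt net m s $ snd e\<bar> \<le> d" if "e \<in> lines net" for e
      using line_drop_bounded[OF eq \<open>m > 0\<close> _ \<open>\<delta> > 0\<close> \<open>K > 0\<close> K[OF eq] that] R
      by (simp add: sqrt)
    then have "\<bar>freq_volt net m s $ i - freq_volt net m s $ j\<bar> \<le> ?L * d" for i j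
      using eq \<open>d > 0\<close> by (intro freq_volt_oscillation_le) (auto simp: equilibrium_def)
    then have "norm (gen s - p_opt) \<le> ?S * (?L * d)"
      using opt by (intro norm_gen_minus_optimal_le[OF Q eq assms(5)])
        (simp_all only: total_generation[OF eq])
    with d show "norm (gen s - p_opt) < \<epsilon>" by linarith
  qed
qed

end
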